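(* Let $a>0$ and for $\Re s>1$ define \[ P(s)=\frac{1}{\Gamma(\frac{s}{2})}\int_0^a\frac{1}{2\sqrt{\pi x}}\sum_{n=2}^\infty \frac{\Lambda(n)}{\sqrt{n}}e^{-\frac{1}{4x}\log^2n}\,x^{\frac{s}{2}}\frac{dx}{x}. \] Then $P(s)$ extends to an entire function given for all $s\in\mathbf{C}$ by the series \[ P(s)=\frac{1}{2\sqrt{\pi}}\sum_{n=2}^\infty \frac{\Lambda(n)}{\sqrt{n}}\frac{\Gamma(\frac{1-s}{2},\frac{\log^2n}{4a})}{\Gamma(\frac{s}{2})}\Bigl(\frac{2}{\log n}\Bigr)^{1-s}. \]
   Context: $\Lambda$ is the von Mangoldt function, $\Gamma(w,z)=\int_z^\infty t^{w-1}e^{-t}\,dt$ is the upper incomplete gamma function, and $1/\Gamma$ is understood as an entire function. *)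

theory Defs
  imports "HOL-Analysis.Analysis" "HOL-Number_Theory.Prime_Powers"
begin

definition upper_Gamma :: "complex \<Rightarrow> real \<Rightarrow> complex" where
  "upper_Gamma w z =
     (LBINT t:{z..}. complex_of_real t powr (w - 1) * complex_of_real (exp (- t)))"

definition theta_term :: "real \<Rightarrow> nat \<Rightarrow> real" where
  "theta_term x n = mangoldt n / sqrt (real n) * exp (- (1 / (4 * x)) * (ln (real n))\<^sup>2)"

text \<open>Sums over \<open>n \<ge> 2\<close> are written with the index shifted by two.\<close>

definition P_integrand :: "complex \<Rightarrow> real \<Rightarrow> complex" where
  "P_integrand s x =
     complex_of_real (1 / (2 * sqrt (pi * x)) * (\<Sum>n. theta_term x (n + 2)))
       * complex_of_real x powr (s / 2) / complex_of_real x"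

definition P :: "real \<Rightarrow> complex \<Rightarrow> complex" where
  "P a s = rGamma (s / 2) * (LBINT x:{0<..<a}. P_integrand s x)"

definition P_series_term :: "real \<Rightarrow> complex \<Rightarrow> nat \<Rightarrow> complex" where
  "P_series_term a s n =
     complex_of_real (mangoldt n / sqrt (real n))
       * (upper_Gamma ((1 - s) / 2) ((ln (real n))\<^sup>2 / (4 * a)) * rGamma (s / 2))
       * complex_of_real (2 / ln (real n)) powr (1 - s)"

end

theory Submission
  imports Defs
begin

text \<open>
  For \<open>0 < x < a\<close> and \<open>n \<ge> 2\<close>, splitting the Gaussian factor in two halves gives
  \<open>exp (- ln\<^sup>2 n / (4x)) \<le> exp (- ln\<^sup>2 n / (8a)) exp (- ln\<^sup>2 2 / (8x))\<close>. The first factor decays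
  faster than any power of \<open>n\<close> and the second one faster than any power of \<open>x\<close> as \<open>x \<rightarrow> 0\<close>, so the
  integral converges absolutely for every complex \<open>s\<close> and may be exchanged with the sum. Each summand
  becomes an incomplete gamma function under the substitution \<open>t = ln\<^sup>2 n / (4x)\<close>. Since the integrand
  depends on \<open>s\<close> only through \<open>exp (s ln x / 2)\<close>, expanding the exponential writes the integral as an
  everywhere convergent power series in \<open>s\<close>, so \<open>P a\<close> is its own entire continuation.
\<close>

section \<open>Integrals depending on a parameter through an exponential\<close>

text \<open>With \<open>R = norm s\<close>, the hypothesis \<open>dom\<close> majorizes the
  integrand and all partial sums of its exponential series at once. Integrating term by term then
  gives a power series in \<open>s\<close> that converges everywhere, so holomorphy needs no
  differentiation under the integral sign.\<close>

lemma
  fixes g :: "'a \<Rightarrow> complex" and h :: "'a \<Rightarrow> real"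
  assumes g [measurable]: "g \<in> borel_measurable M" and h [measurable]: "h \<in> borel_measurable M"
    and dom: "\<And>R. integrable M (\<lambda>x. norm (g x) * exp (R * \<bar>h x\<bar>))"
  shows integrable_mult_exp_of_real: "integrable M (\<lambda>x. g x * exp (s * of_real (h x)))"
    and holomorphic_integral_mult_exp:
      "(\<lambda>s. integral\<^sup>L M (\<lambda>x. g x * exp (s * of_real (h x)))) holomorphic_on A"
proof -
  show int: "integrable M (\<lambda>x. g x * exp (s * of_real (h x)))" for s
  proof (rule Bochner_Integration.integrable_bound[OF dom[of "norm s"]])
    have "Re s * h x \<le> norm s * \<bar>h x\<bar>" for x
      using abs_Re_le_cmod[of s] abs_ge_self[of "Re s * h x"]
      by (metis abs_ge_zero abs_mult mult_right_mono order_trans)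
    then show "AE x in M. norm (g x * exp (s * of_real (h x))) \<le> norm (norm (g x) * exp (norm s * \<bar>h x\<bar>))"
      by (auto simp: norm_mult intro!: mult_left_mono)
  qed measurable
  define c where "c k = integral\<^sup>L M (\<lambda>x. g x * (of_real (h x) ^ k /\<^sub>R fact k))" for k
  have sums: "(\<lambda>k. c k * s ^ k) sums integral\<^sup>L M (\<lambda>x. g x * exp (s * of_real (h x)))" for s
  proof -
    define f where "f k x = g x * ((s * of_real (h x)) ^ k /\<^sub>R fact k)" for k x
    have [measurable]: "f k \<in> borel_measurable M" for k
      unfolding f_def by measurable
    have norm_f: "norm (f k x) = norm (g x) * ((norm s * \<bar>h x\<bar>) ^ k /\<^sub>R fact k)" for k x
      by (simp add: f_def norm_mult norm_power)
    have partial: "(\<Sum>k<n. norm (f k x)) \<le> norm (g x) * exp (norm s * \<bar>h x\<bar>)" for n x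
      unfolding norm_f sum_distrib_left[symmetric]
      unfolding exp_def by (intro mult_left_mono sum_le_suminf sums_summable[OF exp_converges]) auto
    have single: "norm (f k x) \<le> norm (g x) * exp (norm s * \<bar>h x\<bar>)" for k x
      using partial[of x "Suc k"] sum_nonneg[of "{..<k}" "\<lambda>k. norm (f k x)"] by simp
    have int_f: "integrable M (f k)" for k
      by (rule Bochner_Integration.integrable_bound[OF dom[of "norm s"]])
         (auto intro: order_trans[OF single])
    have summ: "summable (\<lambda>k. norm (f k x))" for x
      using partial by (intro summableI_nonneg_bounded) auto
    have "summable (\<lambda>k. \<integral>x. norm (f k x) \<partial>M)"
    proof (rule summableI_nonneg_bounded)
      fix n
      have "(\<Sum>k<n. \<integral>x. norm (f k x) \<partial>M) = (\<integral>x. (\<Sum>k<n. norm (f k x)) \<partial>M)"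
        using int_f by (subst Bochner_Integration.integral_sum) auto
      also have "\<dots> \<le> (\<integral>x. norm (g x) * exp (norm s * \<bar>h x\<bar>) \<partial>M)"
        using int_f dom partial by (intro integral_mono) auto
      finally show "(\<Sum>k<n. \<integral>x. norm (f k x) \<partial>M) \<le> (\<integral>x. norm (g x) * exp (norm s * \<bar>h x\<bar>) \<partial>M)" .
    qed auto
    from sums_integral[OF int_f _ this] summ
    have "(\<lambda>k. integral\<^sup>L M (f k)) sums (\<integral>x. (\<Sum>k. f k x) \<partial>M)"
      by auto
    also have "(\<lambda>x. \<Sum>k. f k x) = (\<lambda>x. g x * exp (s * of_real (h x)))"
      unfolding f_def by (intro ext sums_unique[symmetric] sums_mult exp_converges)
    also have "(\<lambda>k. integral\<^sup>L M (f k)) = (\<lambda>k. c k * s ^ k)"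
      unfolding c_def f_def
      by (subst integral_mult_left_zero[symmetric]) (simp add: power_mult_distrib mult_ac scaleR_conv_of_real)
    finally show ?thesis .
  qed
  have eq: "(\<lambda>s. integral\<^sup>L M (\<lambda>x. g x * exp (s * of_real (h x)))) = (\<lambda>s. \<Sum>k. c k * s ^ k)"
    using sums by (auto simp: sums_iff)
  show "(\<lambda>s. integral\<^sup>L M (\<lambda>x. g x * exp (s * of_real (h x)))) holomorphic_on A"
    unfolding eq holomorphic_on_def field_differentiable_def
    using termdiffs_strong_converges_everywhere[of c] sums by (meson DERIV_subset sums_summable subset_UNIV)
qed

section \<open>Elementary growth estimates in \<open>x\<close> and in \<open>n\<close>\<close>

text \<open>Near 0 the pole \<open>c / x\<close> outweighs the logarithm; for
  \<open>1 \<le> x < a\<close> the logarithm is at most \<open>\<bar>ln a\<bar>\<close>.\<close>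

lemma mult_abs_ln_minus_divide_bounded:
  fixes a c R :: real
  assumes "a > 0" "c > 0"
  obtains K where "\<And>x. 0 < x \<Longrightarrow> x < a \<Longrightarrow> R * \<bar>ln x\<bar> - c / x \<le> K"
proof -
  \<comment> \<open>Adding 1 makes \<open>r\<close> strictly positive even if \<open>R = 0\<close>,
    so that \<open>ln (r / c)\<close> makes sense and division by \<open>r\<close> is
    allowed.\<close>
  define r where "r = \<bar>R\<bar> + 1"
  have r: "r > 0" "R \<le> r" by (auto simp: r_def)
  have "R * \<bar>ln x\<bar> - c / x \<le> r * (\<bar>ln (r / c)\<bar> + \<bar>ln a\<bar>)" if x: "0 < x" "x < a" for x
  proof -
    have "R * \<bar>ln x\<bar> - c / x \<le> r * \<bar>ln x\<bar> - c / x"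
      using r by (simp add: mult_right_mono)
    also have "\<dots> \<le> r * (\<bar>ln (r / c)\<bar> + \<bar>ln a\<bar>)"
    proof (cases "x < 1")
      case True
      \<comment> \<open>The argument is chosen so that multiplying by \<open>r\<close> turns the
        right side into \<open>c / x\<close> minus a constant, which cancels the pole
        exactly.\<close>
      have "ln (c / (r * x)) \<le> c / (r * x) - 1"
        using assms r x by (intro ln_le_minus_one) auto
      moreover have "ln (c / (r * x)) = - ln (r / c) - ln x"
        using assms r x by (simp add: ln_div ln_mult)
      ultimately have "- ln x \<le> ln (r / c) + c / (r * x)" by linarith
      then have "r * (- ln x) \<le> r * (ln (r / c) + c / (r * x))"
        using r by (intro mult_left_mono) auto
      also have "\<dots> = r * ln (r / c) + c / x" using r by (simp add: field_simps)
      also have "r * ln (r / c) \<le> r * (\<bar>ln (r / c)\<bar> + \<bar>ln a\<bar>)"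
        using r by (intro mult_left_mono) auto
      finally show ?thesis using True x by simp
    next
      case False
      then have "\<bar>ln x\<bar> \<le> \<bar>ln a\<bar>" using x by auto
      then have "r * \<bar>ln x\<bar> \<le> r * (\<bar>ln (r / c)\<bar> + \<bar>ln a\<bar>)"
        using r by (intro mult_left_mono) auto
      then show ?thesis using assms x by (smt (verit) divide_pos_pos)
    qed
    finally show ?thesis .
  qed
  then show ?thesis by (rule that)
qed

text \<open>A Gaussian in \<open>ln n\<close> beats every power of \<open>n\<close>, so the crude
  bound of the coefficient by \<open>n\<close> suffices.\<close>

lemma summable_mangoldt_exp_ln_sq:
  fixes a :: real
  assumes "a > 0"
  shows "summable (\<lambda>n. mangoldt n / sqrt (real n) * exp (- ((ln (real n))\<^sup>2 / (8 * a))))"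
proof (rule summable_comparison_test'[where N = 1])
  \<comment> \<open>With \<open>L = ln n\<close>, the maximum of
    \<open>3 * L - L^2 / (8 * a)\<close> is \<open>18 * a\<close>, attained at
    \<open>L = 12 * a\<close>. One \<open>L\<close> pays for the coefficient, the other two give the
    factor \<open>1 / n^2\<close>.\<close>
  show "summable (\<lambda>n. exp (18 * a) * (1 / (real n)\<^sup>2))"
    by (intro summable_mult inverse_power_summable[of 2, simplified inverse_eq_divide]) simp
  fix n :: nat assume n: "n \<ge> 1"
  let ?L = "ln (real n)"
  have "mangoldt n / sqrt (real n) \<le> mangoldt n"
    using n mangoldt_nonneg[of n] by (simp add: divide_le_eq mult_le_cancel_left1)
  also have "\<dots> \<le> exp ?L"
    using mangoldt_le[of n] ln_le_minus_one[of "real n"] n by simp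
  finally have "mangoldt n / sqrt (real n) \<le> exp ?L" .
  then have "mangoldt n / sqrt (real n) * exp (- (?L\<^sup>2 / (8 * a))) \<le> exp (?L - ?L\<^sup>2 / (8 * a))"
    unfolding diff_conv_add_uminus exp_add by (rule mult_right_mono) simp
  also have "?L - ?L\<^sup>2 / (8 * a) \<le> 18 * a - 2 * ?L" \<comment> \<open>complete the square\<close>
  proof -
    have "0 \<le> (?L - 12 * a)\<^sup>2 / (8 * a)" using assms by simp
    also have "\<dots> = ?L\<^sup>2 / (8 * a) - 3 * ?L + 18 * a"
      using assms by (simp add: field_simps power2_eq_square)
    finally show ?thesis by simp
  qed
  also have "exp (18 * a - 2 * ?L) = exp (18 * a) * (1 / (real n)\<^sup>2)"
    using n by (simp add: exp_diff exp_double)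
  finally show "norm (mangoldt n / sqrt (real n) * exp (- (?L\<^sup>2 / (8 * a)))) \<le> exp (18 * a) * (1 / (real n)\<^sup>2)"
    using mangoldt_nonneg[of n] by simp
qed

section \<open>The incomplete gamma function as an integral over a bounded interval\<close>

text \<open>Substitute \<open>t = b / x\<close>, which maps the interval from 0 to \<open>a\<close>
  onto the half-line beyond \<open>b / a\<close>. The Jacobian \<open>b / x^2\<close> times
  \<open>(b / x) powr (w - 1)\<close> is \<open>b powr w\<close> times the power of \<open>x\<close>
  with exponent \<open>- (w + 1)\<close>, written as an exponential of \<open>ln x\<close> to fit
  the parameter integrals.\<close>

lemma upper_Gamma_eq_integral_inverse:
  fixes a b :: real and w :: complex
  assumes a: "a > 0" and b: "b > 0"
    and int: "set_integrable lborel {0<..<a} (\<lambda>x. of_real (exp (- (b / x))) * exp (- (w + 1) * of_real (ln x)))"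
  shows "upper_Gamma w (b / a) = of_real b powr w *
           (LBINT x:{0<..<a}. of_real (exp (- (b / x))) * exp (- (w + 1) * of_real (ln x)))"
proof -
  let ?S = "{0<..<a}" and ?k = "\<lambda>x. of_real (exp (- (b / x))) * exp (- (w + 1) * of_real (ln x))"
  define f where "f t = complex_of_real t powr (w - 1) * complex_of_real (exp (- t))" for t
  have image: "(\<lambda>x. b / x) ` ?S = {b / a<..}"
  proof (intro equalityI subsetI)
    fix t assume t: "t \<in> {b / a<..}"
    then have "t > 0" using a b by (auto intro: less_trans[of 0 "b / a"])
    with t a b show "t \<in> (\<lambda>x. b / x) ` ?S"
      by (intro image_eqI[of _ _ "b / t"]) (auto simp: field_simps)
  qed (use a b in \<open>auto simp: field_simps\<close>)
  have subst: "\<bar>- b / x\<^sup>2\<bar> *\<^sub>R f (b / x) = of_real b powr w * ?k x" if "x \<in> ?S" for x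
  proof -
    have "x > 0" using that by simp
    have "\<bar>- b / x\<^sup>2\<bar> = exp (ln b - 2 * ln x)"
      using \<open>x > 0\<close> b by (simp add: exp_diff exp_double)
    moreover have "complex_of_real (b / x) powr (w - 1) = exp ((w - 1) * of_real (ln b - ln x))"
      using \<open>x > 0\<close> b by (simp add: powr_def Ln_of_real ln_div del: of_real_divide)
    ultimately have "\<bar>- b / x\<^sup>2\<bar> *\<^sub>R f (b / x) =
        exp (of_real (ln b - 2 * ln x)) * exp ((w - 1) * of_real (ln b - ln x)) * of_real (exp (- (b / x)))"
      by (simp add: f_def scaleR_conv_of_real exp_of_real del: of_real_diff)
    also have "exp (of_real (ln b - 2 * ln x)) * exp ((w - 1) * of_real (ln b - ln x)) =
        exp (w * of_real (ln b)) * exp (- (w + 1) * of_real (ln x))"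
      by (simp flip: exp_add add: algebra_simps)
    also have "exp (w * of_real (ln b)) = of_real b powr w"
      using b by (simp add: powr_def Ln_of_real)
    finally show ?thesis by (simp add: mult_ac)
  qed
  have int': "set_integrable lborel ?S (\<lambda>x. of_real b powr w * ?k x)"
    using int by (rule set_integrable_mult_right)
  \<comment> \<open>The change of variables is stated for the completed Lebesgue measure, so
    integrability is first carried over from \<open>lborel\<close>.\<close>
  have "(\<lambda>x. of_real b powr w * ?k x) absolutely_integrable_on ?S"
    using int' unfolding set_integrable_def
    by (subst integrable_completion) auto
  then have "(\<lambda>x. \<bar>- b / x\<^sup>2\<bar> *\<^sub>R f (b / x)) absolutely_integrable_on ?S"
    by (subst set_integrable_cong[OF refl refl subst]) auto
  moreover have "integral ?S (\<lambda>x. \<bar>- b / x\<^sup>2\<bar> *\<^sub>R f (b / x)) = integral ?S (\<lambda>x. of_real b powr w * ?k x)"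
    by (intro integral_cong subst)
  moreover have "((\<lambda>x. b / x) has_field_derivative - b / x\<^sup>2) (at x within ?S)" if "x \<in> ?S" for x
    using that by (auto intro!: derivative_eq_intros simp: power2_eq_square)
  moreover have "inj_on (\<lambda>x. b / x) ?S"
    using b by (auto simp: inj_on_def)
  ultimately have f: "f absolutely_integrable_on {b / a<..}"
      "integral {b / a<..} f = integral ?S (\<lambda>x. of_real b powr w * ?k x)"
    using has_absolute_integral_change_of_variables_real[of ?S "\<lambda>x. b / x" "\<lambda>x. - b / x\<^sup>2" f]
    unfolding image by auto
  \<comment> \<open>Returning to \<open>lborel\<close> requires Borel measurability of
    \<open>f\<close>; it follows from continuity, as the half-line stays away from 0.\<close>
  have "b / a > 0" using a b by simp
  then have "continuous_on {b / a..} f"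
    unfolding f_def by (intro continuous_intros) (auto simp: complex_nonpos_Reals_iff)
  then have meas: "(\<lambda>t. indicator {b / a..} t *\<^sub>R f t) \<in> borel_measurable borel"
      "(\<lambda>t. indicator {b / a<..} t *\<^sub>R f t) \<in> borel_measurable borel"
    by (auto intro!: borel_measurable_continuous_on_indicator elim: continuous_on_subset)
  have "set_integrable lborel {b / a<..} f"
    using f(1) meas unfolding set_integrable_def
    by (subst (asm) integrable_completion) auto
  \<comment> \<open>The closed half-line of the definition and the open image differ by the null set
    \<open>{b / a}\<close>.\<close>
  have "upper_Gamma w (b / a) = (LBINT t:{b / a<..}. f t)"
    unfolding upper_Gamma_def f_def[symmetric] set_lebesgue_integral_def
    by (intro integral_cong_AE AE_I[where N = "{b / a}"]) (use meas in \<open>auto simp: indicator_def\<close>)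
  also have "\<dots> = integral {b / a<..} f"
    by (rule set_borel_integral_eq_integral(2)) fact
  also have "\<dots> = (LBINT x:?S. of_real b powr w * ?k x)"
    unfolding f(2) by (rule set_borel_integral_eq_integral(2)[OF int', symmetric])
  finally show ?thesis by simp
qed

section \<open>Domination of the theta series and exchange of sum and integral\<close>

text \<open>A bounded function on a set of finite measure. Since \<open>R\<close> is arbitrary,
  these majorants serve every complex exponent of \<open>x\<close>.\<close>

lemma integrable_exp_abs_ln_minus_divide:
  fixes a c R :: real
  assumes "a > 0" "c > 0"
  shows "integrable (restrict_space lborel {0<..<a}) (\<lambda>x. exp (R * \<bar>ln x\<bar> - c / x))"
proof -
  obtain K where K: "\<And>x. 0 < x \<Longrightarrow> x < a \<Longrightarrow> R * \<bar>ln x\<bar> - c / x \<le> K"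
    using mult_abs_ln_minus_divide_bounded assms by blast
  have "finite_measure (restrict_space lborel {0<..<a})"
    using assms by (intro finite_measureI) (simp add: emeasure_restrict_space space_restrict_space)
  then show ?thesis
    by (rule finite_measure.integrable_const_bound[where B = "exp K"])
       (auto simp: space_restrict_space K intro!: measurable_restrict_space1)
qed

text \<open>The bound separates the variables: a factor summable in \<open>n\<close> times a factor
  that tames any power of \<open>x\<close> at 0. Each takes half of the exponent, hence 8 in place
  of 4; one half uses \<open>x < a\<close>, the other \<open>n \<ge> 2\<close>.\<close>

lemma norm_theta_term_le:
  fixes a x :: real
  assumes x: "0 < x" "x < a" and n: "n \<ge> 2"
  shows "norm (theta_term x n) \<le>
    mangoldt n / sqrt (real n) * exp (- ((ln (real n))\<^sup>2 / (8 * a))) * exp (- ((ln 2)\<^sup>2 / 8 / x))"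
proof -
  let ?L = "ln (real n)"
  have "?L\<^sup>2 / (8 * a) \<le> ?L\<^sup>2 / (8 * x)"
    using x by (intro divide_left_mono) auto
  moreover have "(ln 2)\<^sup>2 / (8 * x) \<le> ?L\<^sup>2 / (8 * x)"
    using x n by (intro divide_right_mono power_mono) auto
  moreover have "?L\<^sup>2 / (4 * x) = ?L\<^sup>2 / (8 * x) + ?L\<^sup>2 / (8 * x)"
    using x by (simp add: field_simps)
  ultimately have "- (1 / (4 * x)) * ?L\<^sup>2 \<le> - (?L\<^sup>2 / (8 * a)) + - ((ln 2)\<^sup>2 / 8 / x)"
    by simp
  then show ?thesis
    using mangoldt_nonneg[of n]
    by (simp add: theta_term_def abs_mult mult.assoc flip: exp_add) (intro mult_left_mono divide_right_mono; simp)
qed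

definition theta_sum :: "real \<Rightarrow> real" where
  "theta_sum x = (\<Sum>n. theta_term x (n + 2))"

lemma measurable_theta_term [measurable]: "(\<lambda>x. theta_term x n) \<in> borel_measurable borel"
  unfolding theta_term_def by measurable

lemma measurable_theta_sum [measurable]: "theta_sum \<in> borel_measurable borel"
  unfolding theta_sum_def by measurable

text \<open>All claims rest on the bound \<open>A n * exp (- (c / x))\<close> for a single term and,
  after summation, \<open>B * exp (- (c / x))\<close> for \<open>theta_sum\<close>. Multiplied by
  \<open>exp (R * \<bar>ln x\<bar>)\<close> both stay integrable for every \<open>R\<close>, whence
  no restriction on \<open>w\<close>.\<close>

lemma
  fixes a :: real
  assumes a: "a > 0"
  defines "M \<equiv> restrict_space lborel {0<..<a}"
  shows summable_norm_theta_term: "0 < x \<Longrightarrow> x < a \<Longrightarrow> summable (\<lambda>n. norm (theta_term x (n + 2)))"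
    and integrable_theta_term_exp:
      "n \<ge> 2 \<Longrightarrow> integrable M (\<lambda>x. complex_of_real (theta_term x n) * exp (w * of_real (ln x)))"
    and integrable_theta_sum_exp:
      "integrable M (\<lambda>x. complex_of_real (theta_sum x) * exp (w * of_real (ln x)))"
    and sums_integral_theta_term_exp:
      "(\<lambda>n. \<integral>x. complex_of_real (theta_term x (n + 2)) * exp (w * of_real (ln x)) \<partial>M) sums
         (\<integral>x. complex_of_real (theta_sum x) * exp (w * of_real (ln x)) \<partial>M)"
    and holomorphic_integral_theta_sum_exp:
      "(\<lambda>w. \<integral>x. complex_of_real (theta_sum x) * exp (w * of_real (ln x)) \<partial>M) holomorphic_on UNIV"
proof -
  define c where "c = (ln 2 :: real)\<^sup>2 / 8"
  define A where "A n = mangoldt n / sqrt (real n) * exp (- ((ln (real n))\<^sup>2 / (8 * a)))" for n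
  define B where "B = (\<Sum>n. A (n + 2))"
  have c: "c > 0" by (simp add: c_def)
  have A_nonneg: "A n \<ge> 0" for n
    using mangoldt_nonneg[of n] by (simp add: A_def)
  have summ_A: "summable (\<lambda>n. A (n + 2))"
    using summable_mangoldt_exp_ln_sq[OF a] unfolding A_def[symmetric] by (rule summable_ignore_initial_segment)
  have bound: "norm (theta_term x n) \<le> A n * exp (- (c / x))" if "0 < x" "x < a" "n \<ge> 2" for x n
    using norm_theta_term_le[OF that] by (simp add: A_def c_def)
  have summ: "summable (\<lambda>n. norm (theta_term x (n + 2)))" if "0 < x" "x < a" for x
    by (rule summable_comparison_test'[OF summable_mult2[OF summ_A, of "exp (- (c / x))"]])
       (use bound[OF that] in simp)
  then show "0 < x \<Longrightarrow> x < a \<Longrightarrow> summable (\<lambda>n. norm (theta_term x (n + 2)))" for x .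
  have sum_bound: "norm (theta_sum x) \<le> B * exp (- (c / x))" if "0 < x" "x < a" for x
  proof -
    have "norm (theta_sum x) \<le> (\<Sum>n. norm (theta_term x (n + 2)))"
      unfolding theta_sum_def by (intro summable_norm summ that)
    also have "\<dots> \<le> (\<Sum>n. A (n + 2) * exp (- (c / x)))"
      by (intro suminf_le summ summable_mult2 summ_A bound that) simp
    also have "\<dots> = B * exp (- (c / x))"
      unfolding B_def by (rule suminf_mult2[OF summ_A, symmetric])
    finally show ?thesis .
  qed
  have [measurable]: "f \<in> borel_measurable borel \<Longrightarrow> f \<in> borel_measurable M" for f :: "real \<Rightarrow> 'b :: topological_space"
    unfolding M_def by (intro measurable_restrict_space1) simp
  have space_M: "space M = {0<..<a}"
    by (simp add: M_def space_restrict_space)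
  have dominating: "integrable M (\<lambda>x. exp (R * \<bar>ln x\<bar> - c / x))" for R
    unfolding M_def using a c by (rule integrable_exp_abs_ln_minus_divide)
  \<comment> \<open>This is the domination hypothesis of the parameter integrals, applied below with
    \<open>C = A n\<close> for one term and \<open>C = B\<close> for the whole sum.\<close>
  have dom: "integrable M (\<lambda>x. norm (complex_of_real (g x)) * exp (R * \<bar>ln x\<bar>))"
    if g: "g \<in> borel_measurable borel" and bd: "\<And>x. 0 < x \<Longrightarrow> x < a \<Longrightarrow> norm (g x) \<le> C * exp (- (c / x))" for g C R
  proof (rule Bochner_Integration.integrable_bound)
    show "integrable M (\<lambda>x. C * exp (R * \<bar>ln x\<bar> - c / x))"
      by (intro integrable_mult_right dominating)
    have "norm (g x) * exp (R * \<bar>ln x\<bar>) \<le> C * exp (R * \<bar>ln x\<bar> - c / x)" if "0 < x" "x < a" for x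
      using mult_right_mono[OF bd[OF that], of "exp (R * \<bar>ln x\<bar>)"]
      by (simp add: mult.assoc flip: exp_add)
    then show "AE x in M. norm (norm (complex_of_real (g x)) * exp (R * \<bar>ln x\<bar>)) \<le> norm (C * exp (R * \<bar>ln x\<bar> - c / x))"
      by (intro AE_I2) (force simp: space_M)
  qed (use g in measurable)
  have ln_measurable: "ln \<in> borel_measurable M"
    by measurable
  show int_term: "n \<ge> 2 \<Longrightarrow> integrable M (\<lambda>x. complex_of_real (theta_term x n) * exp (w * of_real (ln x)))" for n w
    by (rule integrable_mult_exp_of_real[OF _ ln_measurable dom[OF _ bound]]) auto
  show "integrable M (\<lambda>x. complex_of_real (theta_sum x) * exp (w * of_real (ln x)))" for w
    by (rule integrable_mult_exp_of_real[OF _ ln_measurable dom[OF _ sum_bound]]) auto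
  show "(\<lambda>w. \<integral>x. complex_of_real (theta_sum x) * exp (w * of_real (ln x)) \<partial>M) holomorphic_on UNIV"
    by (rule holomorphic_integral_mult_exp[OF _ ln_measurable dom[OF _ sum_bound]]) auto
  show "(\<lambda>n. \<integral>x. complex_of_real (theta_term x (n + 2)) * exp (w * of_real (ln x)) \<partial>M) sums
         (\<integral>x. complex_of_real (theta_sum x) * exp (w * of_real (ln x)) \<partial>M)"
  proof -
    define f where "f n x = complex_of_real (theta_term x (n + 2)) * exp (w * of_real (ln x))" for n x
    define D where "D = (\<integral>x. exp (norm w * \<bar>ln x\<bar> - c / x) \<partial>M)"
    have int_f: "integrable M (f n)" for n
      unfolding f_def by (rule int_term) simp
    have summ_f: "summable (\<lambda>n. norm (f n x))" if "0 < x" "x < a" for x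
      using summable_mult2[OF summ[OF that]] by (simp add: f_def norm_mult)
    have norm_f: "norm (f n x) \<le> A (n + 2) * exp (norm w * \<bar>ln x\<bar> - c / x)" if "0 < x" "x < a" for n x
    proof -
      have "Re w * ln x \<le> norm w * \<bar>ln x\<bar>"
        using abs_Re_le_cmod[of w] abs_ge_self[of "Re w * ln x"]
        by (metis abs_ge_zero abs_mult mult_right_mono order_trans)
      then have "norm (f n x) \<le> (A (n + 2) * exp (- (c / x))) * exp (norm w * \<bar>ln x\<bar>)"
        unfolding f_def norm_mult using bound[OF that, of "n + 2"] A_nonneg[of "n + 2"]
        by (intro mult_mono) auto
      then show ?thesis
        by (simp add: mult.assoc flip: exp_add)
    qed
    \<comment> \<open>The integrals of the norms are at most \<open>A (n + 2) * D\<close>, because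
      the majorant in \<open>x\<close> is the same for all \<open>n\<close>; this justifies the
      exchange.\<close>
    have "summable (\<lambda>n. \<integral>x. norm (f n x) \<partial>M)"
    proof (rule summable_comparison_test'[OF summable_mult2[OF summ_A, of D]])
      fix n
      have "(\<integral>x. norm (f n x) \<partial>M) \<le> (\<integral>x. A (n + 2) * exp (norm w * \<bar>ln x\<bar> - c / x) \<partial>M)"
        using norm_f by (intro integral_mono integrable_norm int_f integrable_mult_right dominating)
                        (auto simp: space_M)
      then show "norm (\<integral>x. norm (f n x) \<partial>M) \<le> A (n + 2) * D"
        by (simp add: D_def)
    qed
    then have "(\<lambda>n. integral\<^sup>L M (f n)) sums (\<integral>x. (\<Sum>n. f n x) \<partial>M)"
      using summ_f by (intro sums_integral int_f) (auto simp: space_M)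
    moreover have "(\<integral>x. (\<Sum>n. f n x) \<partial>M) = (\<integral>x. complex_of_real (theta_sum x) * exp (w * of_real (ln x)) \<partial>M)"
    proof (rule Bochner_Integration.integral_cong[OF refl])
      fix x assume "x \<in> space M"
      then have s: "summable (\<lambda>n. theta_term x (n + 2))"
        using summ[of x] by (auto simp: space_M intro: summable_norm_cancel)
      show "(\<Sum>n. f n x) = complex_of_real (theta_sum x) * exp (w * of_real (ln x))"
        unfolding f_def theta_sum_def
        by (simp only: suminf_of_real[OF s] suminf_mult2[OF summable_of_real[OF s]])
    qed
    ultimately show ?thesis
      unfolding f_def by simp
  qed
qed

section \<open>Identification of the summands and of the integrand\<close>

text \<open>The substitution formula with \<open>b = L^2 / 4\<close> and
  \<open>w = (1 - s) / 2\<close> applies, since \<open>(s - 3) / 2 = - (w + 1)\<close>. Its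
  prefactor \<open>(L^2 / 4) powr w\<close> equals \<open>(L / 2) powr (1 - s)\<close>, the
  reciprocal of the last factor of \<open>P_series_term\<close>.\<close>

lemma integral_theta_term_exp:
  fixes a :: real and s :: complex
  assumes a: "a > 0" and n: "n \<ge> 2"
  shows "(\<integral>x. complex_of_real (theta_term x n) * exp ((s - 3) / 2 * of_real (ln x)) \<partial>restrict_space lborel {0<..<a}) * rGamma (s / 2)
           = P_series_term a s n"
proof -
  let ?M = "restrict_space lborel {0<..<a}"
  define L where "L = ln (real n)"
  define w where "w = (1 - s) / 2"
  define k where "k x = of_real (exp (- (L\<^sup>2 / 4 / x))) * exp (- (w + 1) * of_real (ln x))" for x
  define m where "m = complex_of_real (mangoldt n / sqrt (real n))"
  have L: "L > 0" using n by (simp add: L_def)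
  have w: "(s - 3) / 2 = - (w + 1)" by (simp add: w_def field_simps)
  have eq: "complex_of_real (theta_term x n) * exp ((s - 3) / 2 * of_real (ln x)) = m * k x" for x
    unfolding theta_term_def k_def m_def w L_def by simp
  show ?thesis
  proof (cases "mangoldt n = (0 :: real)")
    \<comment> \<open>Both sides vanish here. Otherwise the coefficient \<open>m\<close> can be
      divided out, which yields the integrability of \<open>k\<close> from that of the theta
      term.\<close>
    case True
    then show ?thesis by (simp add: P_series_term_def theta_term_def)
  next
    case False
    then have m: "m \<noteq> 0" using n by (simp add: m_def del: of_real_mangoldt of_real_divide)
    have "integrable ?M (\<lambda>x. inverse m * (m * k x))"
      using integrable_theta_term_exp[OF a n, of "(s - 3) / 2"] unfolding eq
      by (rule integrable_mult_right)
    then have int: "integrable ?M k" using m by (simp flip: mult.assoc)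
    have G: "upper_Gamma w (L\<^sup>2 / 4 / a) = of_real (L\<^sup>2 / 4) powr w * (\<integral>x. k x \<partial>?M)"
      using upper_Gamma_eq_integral_inverse[of a "L\<^sup>2 / 4" w, folded k_def] a L int
      by (simp add: set_integrable_eq set_lebesgue_integral_def integral_restrict_space)
    have "of_real (L\<^sup>2 / 4) powr w = exp ((1 - s) * of_real (ln (L / 2)))"
    proof -
      have "L\<^sup>2 / 4 = (L / 2)\<^sup>2" by (simp add: power2_eq_square)
      then have "ln (L\<^sup>2 / 4) = 2 * ln (L / 2)" using L by (simp add: ln_realpow)
      then show ?thesis using L by (simp add: powr_def Ln_of_real w_def del: of_real_divide)
    qed
    moreover have "of_real (2 / L) powr (1 - s) = exp (- ((1 - s) * of_real (ln (L / 2))))"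
      using L by (simp add: powr_def Ln_of_real ln_div algebra_simps del: of_real_divide)
    ultimately have "of_real (L\<^sup>2 / 4) powr w * of_real (2 / L) powr (1 - s) = 1"
      by (simp flip: exp_add)
    then have "upper_Gamma w (L\<^sup>2 / 4 / a) * of_real (2 / L) powr (1 - s) = (\<integral>x. k x \<partial>?M)"
      unfolding G by (metis mult.assoc mult.commute mult_1)
    then show ?thesis
      unfolding eq P_series_term_def m_def[symmetric] L_def[symmetric] w_def[symmetric]
      by (simp add: mult_ac)
  qed
qed

text \<open>The factors \<open>1 / sqrt x\<close>, \<open>x powr (s / 2)\<close> and
  \<open>1 / x\<close> combine to the exponent
  \<open>s / 2 - 1 / 2 - 1 = (s - 3) / 2\<close>.\<close>

lemma P_integrand_eq:
  assumes "x > 0"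
  shows "P_integrand s x =
    of_real (1 / (2 * sqrt pi)) * (complex_of_real (theta_sum x) * exp ((s - 3) / 2 * of_real (ln x)))"
proof -
  have "sqrt x = exp (ln x / 2)"
    using assms by (metis powr_def powr_half_sqrt less_imp_le less_irrefl times_divide_eq_left mult_1)
  then have "complex_of_real (1 / sqrt x) = exp (- of_real (ln x) / 2)"
    by (simp add: exp_minus inverse_eq_divide flip: exp_of_real)
  moreover have "complex_of_real x = exp (of_real (ln x))"
    using assms by (simp add: exp_of_real)
  moreover have "complex_of_real x powr (s / 2) = exp (s / 2 * of_real (ln x))"
    using assms by (simp add: powr_def Ln_of_real)
  ultimately have "complex_of_real (1 / sqrt x) * (complex_of_real x powr (s / 2) / of_real x) =
      exp ((s - 3) / 2 * of_real (ln x))"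
    by (simp flip: exp_add exp_diff) (simp add: diff_divide_distrib algebra_simps)
  moreover have "P_integrand s x = of_real (1 / (2 * sqrt pi)) * (complex_of_real (theta_sum x) *
      (complex_of_real (1 / sqrt x) * (complex_of_real x powr (s / 2) / of_real x)))"
    by (simp add: P_integrand_def theta_sum_def real_sqrt_mult)
  ultimately show ?thesis by simp
qed

section \<open>Entire continuation and series expansion\<close>

theorem theorem3p5:
  fixes a :: real
  assumes "a > 0"
  shows "(\<forall>x. 0 < x \<and> x < a \<longrightarrow> summable (\<lambda>n. theta_term x (n + 2)))
       \<and> (\<forall>s. Re s > 1 \<longrightarrow> set_integrable lborel {0<..<a} (P_integrand s))
       \<and> (\<exists>F. F holomorphic_on UNIV
            \<and> (\<forall>s. Re s > 1 \<longrightarrow> F s = P a s)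
            \<and> (\<forall>s. summable (\<lambda>n. P_series_term a s (n + 2))
                 \<and> F s = complex_of_real (1 / (2 * sqrt pi))
                          * (\<Sum>n. P_series_term a s (n + 2))))"
proof (intro conjI allI impI exI[of _ "P a"])
  let ?M = "restrict_space lborel {0<..<a}"
  define I where "I w = (\<integral>x. complex_of_real (theta_sum x) * exp (w * of_real (ln x)) \<partial>?M)" for w
  define C where "C = complex_of_real (1 / (2 * sqrt pi))"
  have space_M: "space ?M = {0<..<a}" by (simp add: space_restrict_space)
  have P_eq: "P a s = C * (I ((s - 3) / 2) * rGamma (s / 2))" for s
  proof -
    have "(LBINT x:{0<..<a}. P_integrand s x) = (\<integral>x. P_integrand s x \<partial>?M)"
      by (simp add: set_lebesgue_integral_def integral_restrict_space)
    also have "\<dots> = (\<integral>x. C * (complex_of_real (theta_sum x) * exp ((s - 3) / 2 * of_real (ln x))) \<partial>?M)"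
      by (rule Bochner_Integration.integral_cong[OF refl])
         (simp only: P_integrand_eq space_M C_def greaterThanLessThan_iff)
    also have "\<dots> = C * I ((s - 3) / 2)"
      unfolding I_def by (rule integral_mult_right_zero)
    finally show ?thesis by (simp add: P_def mult_ac)
  qed
  show "summable (\<lambda>n. theta_term x (n + 2))" if "0 < x \<and> x < a" for x
    using summable_norm_theta_term[OF assms, of x] that by (auto intro: summable_norm_cancel)
  \<comment> \<open>Integrability is obtained for every \<open>s\<close>, not only in the half-plane
    \<open>Re s > 1\<close>; hence \<open>P a\<close> itself can serve as the witness.\<close>
  show "set_integrable lborel {0<..<a} (P_integrand s)" for s
  proof -
    have "integrable ?M (\<lambda>x. C * (complex_of_real (theta_sum x) * exp ((s - 3) / 2 * of_real (ln x))))"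
      by (intro integrable_mult_right integrable_theta_sum_exp assms)
    also have "?this \<longleftrightarrow> integrable ?M (P_integrand s)"
      by (rule Bochner_Integration.integrable_cong[OF refl])
         (simp only: P_integrand_eq space_M C_def greaterThanLessThan_iff)
    finally show ?thesis by (simp add: set_integrable_eq)
  qed
  have I: "I holomorphic_on UNIV"
    unfolding I_def by (rule holomorphic_integral_theta_sum_exp[OF assms])
  have "(\<lambda>s. I ((s - 3) / 2)) holomorphic_on UNIV"
    by (rule holomorphic_on_compose_gen[OF _ I, unfolded o_def]) (auto intro!: holomorphic_intros)
  \<comment> \<open>\<open>rGamma\<close> is entire, so the product has no singularities.\<close>
  then show "P a holomorphic_on UNIV"
    unfolding P_eq[abs_def] by (intro holomorphic_intros) auto
  have "(\<lambda>n. P_series_term a s (n + 2)) sums (I ((s - 3) / 2) * rGamma (s / 2))" for s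
    using sums_mult2[OF sums_integral_theta_term_exp[OF assms, of "(s - 3) / 2"], of "rGamma (s / 2)"]
      integral_theta_term_exp[OF assms, of _ s]
    unfolding I_def by simp
  then show "summable (\<lambda>n. P_series_term a s (n + 2))"
    "P a s = complex_of_real (1 / (2 * sqrt pi)) * (\<Sum>n. P_series_term a s (n + 2))" for s
    by (auto simp: sums_iff P_eq C_def)
qed simp

end
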